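(* For every fixed order $\sigma$ of the agents, the mechanism SDMT-1 (defined in the context) for House Allocation with ties is truthful: for all preference profiles $L$, agents $i$ and lists $L'(i)$, agent $i$ weakly prefers, according to $L(i)$, his outcome when SDMT-1 is run on $(L(i),L(-i))$ to his outcome when it is run on $(L'(i),L(-i))$.
   Context: House Allocation (HA). $N$ is a finite set of agents, $O$ a finite set of objects with $|O|=n_2$. Each agent $i$ has a preference list $L(i)=(C^i_1\succ_i C^i_2\succ_i\cdots)$, an ordered sequence of pairwise disjoint subsets of $O$ (indifference classes, all nonempty classes coming first); objects in $C^i_k$ are strictly preferred to those in $C^i_l$ for $k<l$, and $i$ is indifferent between objects in the same class. Objects in $\bigcup_k C^i_k$ are acceptable to $i$. $rank(i,o)=k$ if $o\in C^i_k$, and $n_2+1$ if $o$ is unacceptable or if $i$ is unmatched; $i$ prefers smaller rank. $L(-i)$ denotes the lists of all agents other than $i$. A matching is a set of (agent, acceptable object) pairs in which every agent and every object occurs at most once. SDMT-1, given an order $\sigma$ of the agents: start with the bipartite graph $G=(N\cup O,E)$, $E=\emptyset$, and $\mu=\emptyset$. Process agents in the order $\sigma$. For the current agent $i$, for $\ell=1,2,\dots$ while $C^i_\ell\neq\emptyset$: add the edges $\{(i,o):o\in C^i_\ell\}$ to $E$; if $G$ contains an augmenting path with respect to $\mu$ starting at $i$ (a path from $i$ to an unmatched object, alternating between edges not in $\mu$ and edges in $\mu$), choose any such path, replace $\mu$ by its symmetric difference with the path, and go to the next agent; otherwise remove the edges just added and increase $\ell$ by one. Return $\mu$ after all agents are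 processed. The choice of augmenting paths is arbitrary. *)

theory Defs
  imports Main
begin

text \<open>
  A preference list is the sequence of its indifference classes \<open>C 1, C 2, \<dots>\<close>, followed
  by empty classes; \<open>C 0\<close> is not part of the list. Agents and objects have the types
  \<open>'a\<close> and \<open>'o\<close>; a profile maps each agent to a preference list.
\<close>

type_synonym 'o prefs = "nat \<Rightarrow> 'o set"

definition pref_list :: "'o set \<Rightarrow> 'o prefs \<Rightarrow> bool" where
  "pref_list Ob C \<longleftrightarrow>
     (\<forall>k\<ge>1. C k \<subseteq> Ob) \<and>
     (\<forall>k\<ge>1. \<forall>l\<ge>1. k \<noteq> l \<longrightarrow> C k \<inter> C l = {}) \<and>
     (\<forall>k\<ge>1. \<forall>l\<ge>k. C k = {} \<longrightarrow> C l = {})"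

definition pref_profile :: "'a set \<Rightarrow> 'o set \<Rightarrow> ('a \<Rightarrow> 'o prefs) \<Rightarrow> bool" where
  "pref_profile N Ob L \<longleftrightarrow> (\<forall>i\<in>N. pref_list Ob (L i))"

definition acceptable :: "'o prefs \<Rightarrow> 'o set" where
  "acceptable C = (\<Union>k\<in>{1..}. C k)"

text \<open>The outcome of an agent is \<open>None\<close> if he is unmatched.\<close>

definition outcome :: "('a \<times> 'o) set \<Rightarrow> 'a \<Rightarrow> 'o option" where
  "outcome \<mu> i = (if \<exists>x. (i, x) \<in> \<mu> then Some (THE x. (i, x) \<in> \<mu>) else None)"

definition rank :: "'o set \<Rightarrow> 'o prefs \<Rightarrow> 'o option \<Rightarrow> nat" where
  "rank Ob C y = (case y of
       None \<Rightarrow> card Ob + 1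
     | Some x \<Rightarrow> if x \<in> acceptable C then (THE k. 1 \<le> k \<and> x \<in> C k) else card Ob + 1)"

definition weakly_prefers :: "'o set \<Rightarrow> 'o prefs \<Rightarrow> 'o option \<Rightarrow> 'o option \<Rightarrow> bool" where
  "weakly_prefers Ob C y z \<longleftrightarrow> rank Ob C y \<le> rank Ob C z"

text \<open>
  An edge set of the bipartite graph is a set of (agent, object) pairs. Vertices of the graph
  live in the disjoint sum \<open>'a + 'o\<close>, and \<open>links E\<close> consists of the edges as unordered pairs
  of vertices.
\<close>

definition links :: "('a \<times> 'o) set \<Rightarrow> ('a + 'o) set set" where
  "links E = {{Inl i, Inr x} | i x. (i, x) \<in> E}"

definition path_edges :: "('a + 'o) list \<Rightarrow> ('a \<times> 'o) set" where
  "path_edges p = {(i, x). \<exists>k. Suc k < length p \<and> {p ! k, p ! Suc k} = {Inl i, Inr x}}"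

definition augmenting_path ::
  "('a \<times> 'o) set \<Rightarrow> ('a \<times> 'o) set \<Rightarrow> 'a \<Rightarrow> ('a + 'o) list \<Rightarrow> bool" where
  "augmenting_path E \<mu> i p \<longleftrightarrow>
     p \<noteq> [] \<and> distinct p \<and> hd p = Inl i \<and>
     (\<exists>x. last p = Inr x \<and> x \<notin> snd ` \<mu>) \<and>
     (\<forall>k. Suc k < length p \<longrightarrow>
        {p ! k, p ! Suc k} \<in> (if even k then links (E - \<mu>) else links (E \<inter> \<mu>)))"

text \<open>
  The mechanism is given as a relation because the augmenting paths are arbitrary; a state is
  the current edge set together with the current matching. \<open>process C i l s s'\<close>: processing
  agent \<open>i\<close> with list \<open>C\<close>, starting at class \<open>l\<close>, can lead from \<open>s\<close> to \<open>s'\<close>.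
\<close>

type_synonym ('a, 'o) state = "('a \<times> 'o) set \<times> ('a \<times> 'o) set"

inductive process ::
  "'o prefs \<Rightarrow> 'a \<Rightarrow> nat \<Rightarrow> ('a, 'o) state \<Rightarrow> ('a, 'o) state \<Rightarrow> bool"
  for C i where
  exhausted: "C l = {} \<Longrightarrow> process C i l (E, \<mu>) (E, \<mu>)"
| augment: "C l \<noteq> {} \<Longrightarrow> E' = E \<union> {i} \<times> C l \<Longrightarrow> augmenting_path E' \<mu> i p \<Longrightarrow>
    process C i l (E, \<mu>) (E', sym_diff \<mu> (path_edges p))"
| next_class: "C l \<noteq> {} \<Longrightarrow> \<nexists>p. augmenting_path (E \<union> {i} \<times> C l) \<mu> i p \<Longrightarrow>
    process C i (Suc l) (E, \<mu>) s \<Longrightarrow> process C i l (E, \<mu>) s"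

inductive sdmt1_run ::
  "('a \<Rightarrow> 'o prefs) \<Rightarrow> 'a list \<Rightarrow> ('a, 'o) state \<Rightarrow> ('a, 'o) state \<Rightarrow> bool"
  for L where
  finished: "sdmt1_run L [] s s"
| agent: "process (L i) i 1 s s' \<Longrightarrow> sdmt1_run L \<sigma> s' s'' \<Longrightarrow> sdmt1_run L (i # \<sigma>) s s''"

definition sdmt1 :: "'a list \<Rightarrow> ('a \<Rightarrow> 'o prefs) \<Rightarrow> ('a \<times> 'o) set \<Rightarrow> bool" where
  "sdmt1 \<sigma> L \<mu> \<longleftrightarrow> (\<exists>E. sdmt1_run L \<sigma> ({}, {}) (E, \<mu>))"

text \<open>
  \<open>M L \<mu>\<close> means that \<open>\<mu>\<close> is a possible result of the mechanism on profile \<open>L\<close>.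
  The choices made in the truthful run and in the misreporting run are independent.
\<close>

definition truthful ::
  "'a set \<Rightarrow> 'o set \<Rightarrow> (('a \<Rightarrow> 'o prefs) \<Rightarrow> ('a \<times> 'o) set \<Rightarrow> bool) \<Rightarrow> bool" where
  "truthful N Ob M \<longleftrightarrow>
     (\<forall>L i C' \<mu> \<mu>'. pref_profile N Ob L \<longrightarrow> i \<in> N \<longrightarrow> pref_list Ob C' \<longrightarrow>
        M L \<mu> \<longrightarrow> M (L(i := C')) \<mu>' \<longrightarrow>
        weakly_prefers Ob (L i) (outcome \<mu> i) (outcome \<mu>' i))"

text \<open>Every run terminates, so truthfulness of \<open>sdmt1\<close> is not vacuous.\<close>

lemma pref_list_bounded:
  assumes "finite Ob" "pref_list Ob C" "l > card Ob"
  shows "C l = {}"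
proof (rule ccontr)
  assume ne: "C l \<noteq> {}"
  have ex: "\<exists>x. x \<in> C k" if "k \<in> {1..l}" for k
    using that ne assms(2) unfolding pref_list_def by fastforce
  define f where "f k = (SOME x. x \<in> C k)" for k
  have f: "f k \<in> C k" if "k \<in> {1..l}" for k
    using someI_ex[OF ex[OF that]] unfolding f_def .
  have "inj_on f {1..l}"
  proof (rule inj_onI, rule ccontr)
    fix a b assume ab: "a \<in> {1..l}" "b \<in> {1..l}" "f a = f b" "a \<noteq> b"
    then have "C a \<inter> C b = {}" using assms(2) unfolding pref_list_def by auto
    then show False using f[OF ab(1)] f[OF ab(2)] ab(3) by auto
  qed
  moreover have "f ` {1..l} \<subseteq> Ob"
    using f assms(2) unfolding pref_list_def by fastforce
  ultimately have "card {1..l} \<le> card Ob"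
    using assms(1) card_inj_on_le by blast
  then show False using assms(3) by simp
qed

lemma process_total:
  assumes "finite Ob" "pref_list Ob C"
  shows "\<exists>s'. process C i l s s'"
proof (induction "Suc (card Ob) - l" arbitrary: l)
  case 0
  then have "C l = {}" using pref_list_bounded[OF assms] by simp
  then show ?case by (cases s) (blast intro: exhausted)
next
  case (Suc n)
  then have "\<exists>s'. process C i (Suc l) s s'" by simp
  then show ?case
    by (cases s) (blast intro: exhausted augment next_class)
qed

lemma sdmt1_run_total:
  assumes "finite Ob" "\<forall>i\<in>set \<sigma>. pref_list Ob (L i)"
  shows "\<exists>s'. sdmt1_run L \<sigma> s s'"
  using assms(2)
proof (induction \<sigma> arbitrary: s)
  case Nil
  then show ?case by (blast intro: finished)
next
  case (Cons i \<sigma>)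
  obtain s' where "process (L i) i 1 s s'"
    using process_total[OF assms(1)] Cons.prems by fastforce
  moreover obtain s'' where "sdmt1_run L \<sigma> s' s''"
    using Cons.IH Cons.prems by fastforce
  ultimately show ?case by (blast intro: agent)
qed

lemma sdmt1_total:
  assumes "finite Ob" "pref_profile N Ob L" "set \<sigma> = N"
  shows "\<exists>\<mu>. sdmt1 \<sigma> L \<mu>"
proof -
  have "\<forall>i\<in>set \<sigma>. pref_list Ob (L i)"
    using assms(2,3) by (simp add: pref_profile_def)
  from sdmt1_run_total[OF assms(1) this] show ?thesis
    unfolding sdmt1_def by (metis prod.exhaust)
qed

end

theory Submission
  imports Defs
begin

text \<open>
  The matching always saturates every agent that has edges. Hence, by a Hall-type counting
  argument, an augmenting path from the current agent exists iff the extended graph has a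
  matching saturating all agents with edges. So the edge set evolves independently of the chosen
  paths, and agent \<open>i\<close> is assigned the first class \<open>C k\<close> for which the graph extended by
  \<open>{i} \<times> C k\<close> has such a matching. Restricting the result of the misreporting run to \<open>i\<close> and his
  predecessors shows that an object obtained by misreporting lies in a class with this property.
\<close>

section \<open>Matchings, saturation and ranks\<close>

definition matching :: "('a \<times> 'o) set \<Rightarrow> bool" where
  "matching \<mu> \<longleftrightarrow> (\<forall>a x b y. (a, x) \<in> \<mu> \<longrightarrow> (b, y) \<in> \<mu> \<longrightarrow> (a = b \<longleftrightarrow> x = y))"

text \<open>An agent who exhausts his list has no edges. Saturating only the agents with edges is
  therefore preserved by the mechanism, even when some agents remain unmatched.\<close>

definition saturating :: "('a \<times> 'o) set \<Rightarrow> ('a \<times> 'o) set \<Rightarrow> bool" where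
  "saturating E \<mu> \<longleftrightarrow> matching \<mu> \<and> \<mu> \<subseteq> E \<and> fst ` \<mu> = fst ` E"

definition saturable :: "('a \<times> 'o) set \<Rightarrow> bool" where
  "saturable E \<longleftrightarrow> (\<exists>\<mu>. saturating E \<mu>)"

lemma matchingD:
  assumes "matching \<mu>" "(a, x) \<in> \<mu>" "(b, y) \<in> \<mu>"
  shows "a = b \<longleftrightarrow> x = y"
  using assms unfolding matching_def by blast

lemma outcome_eq_Some_iff:
  assumes "matching \<mu>"
  shows "outcome \<mu> i = Some x \<longleftrightarrow> (i, x) \<in> \<mu>"
proof -
  have "(THE y. (i, y) \<in> \<mu>) = z" if "(i, z) \<in> \<mu>" for z
    using that matchingD[OF assms] by (blast intro: the_equality)
  then show ?thesis
    unfolding outcome_def by auto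
qed

lemma rank_eq:
  assumes "pref_list Ob C" "1 \<le> k" "x \<in> C k"
  shows "rank Ob C (Some x) = k"
proof -
  have "(THE k. 1 \<le> k \<and> x \<in> C k) = k"
    using assms unfolding pref_list_def by (intro the_equality) blast+
  then show ?thesis
    using assms unfolding rank_def acceptable_def by auto
qed

section \<open>Augmenting a saturating matching along a path\<close>

lemma isl_links:
  assumes "{u, v} \<in> links E"
  shows "isl u \<longleftrightarrow> \<not> isl v"
  using assms unfolding links_def by (auto simp: doubleton_eq_iff)

text \<open>Reads the path as \<open>a 0, x 0, a 1, x 1, ..., a n, x n\<close>, so that its
  symmetric difference with \<open>\<mu>\<close> can be computed by indices.\<close>

lemma augmenting_pathE:
  assumes "augmenting_path E \<mu> i p"
  obtains n a x where
    "a 0 = i" "inj_on a {..n}" "inj_on x {..n}" "x n \<notin> snd ` \<mu>"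
    "\<And>j. j \<le> n \<Longrightarrow> (a j, x j) \<in> E - \<mu>"
    "\<And>j. j < n \<Longrightarrow> (a (Suc j), x j) \<in> E \<inter> \<mu>"
    "path_edges p = (\<lambda>j. (a j, x j)) ` {..n} \<union> (\<lambda>j. (a (Suc j), x j)) ` {..<n}"
proof -
  have ne: "p \<noteq> []" and dist: "distinct p" and hd: "p ! 0 = Inl i"
    using assms by (auto simp: augmenting_path_def hd_conv_nth)
  have link: "{p ! k, p ! Suc k} \<in> (if even k then links (E - \<mu>) else links (E \<inter> \<mu>))"
    if "Suc k < length p" for k
    using assms that by (auto simp: augmenting_path_def)
  obtain z where z: "p ! (length p - 1) = Inr z" "z \<notin> snd ` \<mu>"
    using assms ne by (auto simp: augmenting_path_def last_conv_nth)
  \<comment> \<open>Each link joins an agent and an object and the path starts at an agent, so the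
    two kinds of vertices alternate.\<close>
  have par: "isl (p ! k) \<longleftrightarrow> even k" if "k < length p" for k
    using that
  proof (induction k)
    case 0
    then show ?case using hd by simp
  next
    case (Suc k)
    then show ?case
      using link[of k] isl_links[of "p ! k" "p ! Suc k"] by (auto split: if_splits)
  qed
  have "odd (length p - 1)"
    using par[of "length p - 1"] z ne by auto
  then obtain n where "length p - 1 = 2 * n + 1"
    by (rule oddE)
  then have n: "length p = 2 * n + 2"
    by simp
  define a where "a j = projl (p ! (2 * j))" for j
  define x where "x j = projr (p ! Suc (2 * j))" for j
  have a: "p ! (2 * j) = Inl (a j)" if "j \<le> n" for j
    using par[of "2 * j"] that n by (simp add: a_def)
  have x: "p ! Suc (2 * j) = Inr (x j)" if "j \<le> n" for j
    using par[of "Suc (2 * j)"] that n by (cases "p ! Suc (2 * j)") (simp_all add: x_def)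
  show thesis
  proof (rule that)
    show "a 0 = i"
      using a[of 0] hd by simp
    show "inj_on a {..n}"
    proof (rule inj_onI)
      fix j k assume "j \<in> {..n}" "k \<in> {..n}" "a j = a k"
      then show "j = k"
        using a[of j] a[of k] nth_eq_iff_index_eq[OF dist, of "2 * j" "2 * k"] n by auto
    qed
    show "inj_on x {..n}"
    proof (rule inj_onI)
      fix j k assume "j \<in> {..n}" "k \<in> {..n}" "x j = x k"
      then show "j = k"
        using x[of j] x[of k] nth_eq_iff_index_eq[OF dist, of "Suc (2 * j)" "Suc (2 * k)"] n
        by auto
    qed
    show "x n \<notin> snd ` \<mu>"
      using x[of n] z n by simp
    show "(a j, x j) \<in> E - \<mu>" if "j \<le> n" for j
      using link[of "2 * j"] a[of j] x[of j] that n
      by (auto simp: links_def doubleton_eq_iff)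
    show "(a (Suc j), x j) \<in> E \<inter> \<mu>" if "j < n" for j
      using link[of "Suc (2 * j)"] a[of "Suc j"] x[of j] that n
      by (auto simp: links_def doubleton_eq_iff)
    show "path_edges p = (\<lambda>j. (a j, x j)) ` {..n} \<union> (\<lambda>j. (a (Suc j), x j)) ` {..<n}"
      (is "_ = ?R")
    proof (intro equalityI subsetI)
      fix e assume "e \<in> path_edges p"
      then obtain b y k where e: "e = (b, y)" and k: "Suc k < length p"
        and eq: "{p ! k, p ! Suc k} = {Inl b, Inr y}"
        unfolding path_edges_def by auto
      show "e \<in> ?R"
      proof (cases "even k")
        case True
        then obtain j where j: "k = 2 * j" by (rule evenE)
        then have "j \<le> n" using k n by simp
        then show ?thesis
          using eq a[of j] x[of j] e j by (auto simp: doubleton_eq_iff)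
      next
        case False
        then obtain j where j: "k = Suc (2 * j)" by (auto elim: oddE)
        then have "j < n" using k n by simp
        then show ?thesis
          using eq a[of "Suc j"] x[of j] e j by (auto simp: doubleton_eq_iff)
      qed
    next
      fix e assume "e \<in> ?R"
      then consider j where "j \<le> n" "e = (a j, x j)" | j where "j < n" "e = (a (Suc j), x j)"
        by auto
      then show "e \<in> path_edges p"
      proof cases
        case 1
        then show ?thesis
          using a[of j] x[of j] n unfolding path_edges_def by (auto intro!: exI[of _ "2 * j"])
      next
        case 2
        then show ?thesis
          using a[of "Suc j"] x[of j] n unfolding path_edges_def
          by (auto intro!: exI[of _ "Suc (2 * j)"])
      qed
    qed
  qed
qed

text \<open>Along the path each \<open>a (Suc j)\<close> trades \<open>x j\<close> for
  \<open>x (Suc j)\<close>, while \<open>i\<close> receives \<open>x 0\<close>. No agent loses his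
  partner, and the only new object \<open>x n\<close> was free.\<close>

lemma saturating_augment:
  assumes \<mu>: "saturating E \<mu>" and i: "i \<notin> fst ` E"
    and p: "augmenting_path (E \<union> {i} \<times> C) \<mu> i p"
  shows "saturating (E \<union> {i} \<times> C) (sym_diff \<mu> (path_edges p))"
proof -
  let ?E = "E \<union> {i} \<times> C"
  obtain n a x where a0: "a 0 = i" and inja: "inj_on a {..n}" and injx: "inj_on x {..n}"
    and xn: "x n \<notin> snd ` \<mu>"
    and out: "\<And>j. j \<le> n \<Longrightarrow> (a j, x j) \<in> ?E - \<mu>"
    and inn: "\<And>j. j < n \<Longrightarrow> (a (Suc j), x j) \<in> ?E \<inter> \<mu>"
    and pe: "path_edges p = (\<lambda>j. (a j, x j)) ` {..n} \<union> (\<lambda>j. (a (Suc j), x j)) ` {..<n}"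
    by (rule augmenting_pathE[OF p]) blast
  have m: "matching \<mu>" and sub: "\<mu> \<subseteq> E" and dom: "fst ` \<mu> = fst ` E"
    using \<mu> by (auto simp: saturating_def)
  let ?\<nu> = "sym_diff \<mu> (path_edges p)"
  \<comment> \<open>The new matching consists of the pairs \<open>(a j, x j)\<close> and of the old
    edges that avoid all vertices of the path. The two kinds share no vertex, which makes the
    matching property a case distinction.\<close>
  have \<nu>: "(b, y) \<in> ?\<nu> \<longleftrightarrow>
      (\<exists>j\<le>n. b = a j \<and> y = x j) \<or> ((b, y) \<in> \<mu> \<and> b \<notin> a ` {..n} \<and> y \<notin> x ` {..n})" for b y
  proof -
    have "(b, y) \<in> path_edges p" if bm: "(b, y) \<in> \<mu>" and "b \<in> a ` {..n} \<or> y \<in> x ` {..n}"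
      using that(2)
    proof
      assume "b \<in> a ` {..n}"
      then obtain j where j: "j \<le> n" "b = a j" by auto
      \<comment> \<open>\<open>a 0 = i\<close> has no edge in \<open>E\<close>, hence none in
        \<open>\<mu>\<close>; every other agent on the path has his \<open>\<mu>\<close>-edge on the
        path.\<close>
      moreover have "j \<noteq> 0"
        using bm a0 i sub j by (force intro: rev_image_eqI)
      ultimately obtain k where "k < n" "b = a (Suc k)"
        using not0_implies_Suc Suc_le_lessD by metis
      then show ?thesis
        using inn[of k] matchingD[OF m bm, of "a (Suc k)" "x k"] pe by auto
    next
      assume "y \<in> x ` {..n}"
      then obtain j where j: "j \<le> n" "y = x j" by auto
      \<comment> \<open>\<open>x n\<close> is free in \<open>\<mu>\<close>, and the partner of an
        earlier \<open>x j\<close> is \<open>a (Suc j)\<close>.\<close>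
      then have "j < n"
        using bm xn by (cases "j = n") (auto intro: rev_image_eqI)
      then show ?thesis
        using inn[of j] matchingD[OF m bm, of "a (Suc j)" "x j"] j pe by auto
    qed
    moreover have "b \<in> a ` {..n} \<and> y \<in> x ` {..n}" if "(b, y) \<in> path_edges p"
      using that pe by force
    moreover have "(b, y) \<in> path_edges p - \<mu> \<longleftrightarrow> (\<exists>j\<le>n. b = a j \<and> y = x j)"
      using pe out inn by auto
    ultimately show ?thesis
      by blast
  qed
  have "matching ?\<nu>"
    unfolding matching_def
  proof (intro allI impI)
    fix b y c z assume "(b, y) \<in> ?\<nu>" "(c, z) \<in> ?\<nu>"
    then show "b = c \<longleftrightarrow> y = z"
      unfolding \<nu> using inj_on_eq_iff[OF inja] inj_on_eq_iff[OF injx] matchingD[OF m, of b y c z]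
      by (elim disjE exE conjE) auto
  qed
  moreover have "?\<nu> \<subseteq> ?E"
  proof
    fix e assume "e \<in> ?\<nu>"
    moreover obtain b y where "e = (b, y)" by (cases e)
    ultimately show "e \<in> ?E" using sub out \<nu>[of b y] by blast
  qed
  moreover have "fst ` ?E \<subseteq> fst ` ?\<nu>"
  proof -
    have "b \<in> fst ` ?\<nu>" if "b \<in> fst ` \<mu> \<or> b = i" for b
    proof (cases "b \<in> a ` {..n}")
      case True
      then obtain j where "(b, x j) \<in> ?\<nu>" using \<nu> by blast
      then show ?thesis by force
    next
      case False
      then have "b \<in> fst ` \<mu>" using that a0 by auto
      then obtain y where y: "(b, y) \<in> \<mu>" by auto
      then have "(b, y) \<notin> path_edges p" using False pe by force
      then show ?thesis using y by force
    qed
    then show ?thesis using dom by auto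
  qed
  ultimately show ?thesis
    unfolding saturating_def by (blast intro: image_mono)
qed

section \<open>Reachability by alternating paths and Hall's condition\<close>

text \<open>Paths end at agents and grow by an object together with its
  \<open>\<mu>\<close>-partner. Both must be new, since an augmenting path may not repeat
  vertices.\<close>

inductive alternating ::
  "('a \<times> 'o) set \<Rightarrow> ('a \<times> 'o) set \<Rightarrow> 'a \<Rightarrow> ('a + 'o) list \<Rightarrow> 'a \<Rightarrow> bool"
  for E \<mu> i where
  start: "alternating E \<mu> i [Inl i] i"
| extend: "alternating E \<mu> i p b \<Longrightarrow> (b, x) \<in> E - \<mu> \<Longrightarrow> (c, x) \<in> E \<inter> \<mu> \<Longrightarrow>
    Inr x \<notin> set p \<Longrightarrow> Inl c \<notin> set p \<Longrightarrow> alternating E \<mu> i (p @ [Inr x, Inl c]) c"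

lemma alternating_props:
  assumes "alternating E \<mu> i p b"
  shows "odd (length p) \<and> distinct p \<and> hd p = Inl i \<and> last p = Inl b \<and>
    (\<forall>k. Suc k < length p \<longrightarrow>
      {p ! k, p ! Suc k} \<in> (if even k then links (E - \<mu>) else links (E \<inter> \<mu>)))"
  using assms
proof induction
  case start
  then show ?case by simp
next
  case (extend p b x c)
  then have ne: "p \<noteq> []" by auto
  have "{(p @ [Inr x, Inl c]) ! k, (p @ [Inr x, Inl c]) ! Suc k}
      \<in> (if even k then links (E - \<mu>) else links (E \<inter> \<mu>))"
    if "Suc k < length (p @ [Inr x, Inl c])" for k
  proof -
    have "Suc k < length p \<or> Suc k = length p \<or> k = length p"
      using that by auto
    then consider "Suc k < length p" | "Suc k = length p" | "k = length p"
      by blast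
    then show ?thesis
    proof cases
      case 1
      then show ?thesis using extend by (auto simp: nth_append)
    next
      case 2
      then have "p ! k = Inl b"
        using extend ne last_conv_nth[of p] by (metis diff_Suc_1)
      moreover have "even k"
        using 2 extend by (metis even_Suc)
      ultimately show ?thesis using 2 extend.hyps by (auto simp: nth_append links_def)
    next
      case 3
      then show ?thesis
        using extend by (auto simp: nth_append links_def doubleton_eq_iff)
    qed
  qed
  then show ?case using extend ne by auto
qed

text \<open>Every prefix ending at an agent is itself such a path, and each object on the path is
  followed by its partner. This handles neighbours that already lie on the path, where it cannot be
  extended.\<close>

lemma alternating_vertices:
  assumes "alternating E \<mu> i p b"
  shows "(Inl c \<in> set p \<longrightarrow> (\<exists>q. alternating E \<mu> i q c)) \<and>
    (Inr x \<in> set p \<longrightarrow> (\<exists>c q. (c, x) \<in> \<mu> \<and> alternating E \<mu> i q c))"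
  using assms
proof induction
  case start
  then show ?case by (auto intro: alternating.start)
next
  case (extend p b y d)
  have "alternating E \<mu> i (p @ [Inr y, Inl d]) d"
    using extend.hyps by (rule alternating.extend)
  then show ?case using extend by auto
qed

lemma augmenting_path_snoc:
  assumes "alternating E \<mu> i p b" "(b, x) \<in> E - \<mu>" "Inr x \<notin> set p" "x \<notin> snd ` \<mu>"
  shows "augmenting_path E \<mu> i (p @ [Inr x])"
proof -
  note p = alternating_props[OF assms(1)]
  then have ne: "p \<noteq> []" by auto
  have "{(p @ [Inr x]) ! k, (p @ [Inr x]) ! Suc k}
      \<in> (if even k then links (E - \<mu>) else links (E \<inter> \<mu>))"
    if "Suc k < length (p @ [Inr x])" for k
  proof (cases "Suc k = length p")
    case True
    then have "p ! k = Inl b"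
      using p ne last_conv_nth[of p] by (metis diff_Suc_1)
    moreover have "even k"
      using True p by (metis even_Suc)
    ultimately show ?thesis using True assms by (auto simp: nth_append links_def)
  next
    case False
    then show ?thesis using p that by (auto simp: nth_append)
  qed
  then show ?thesis
    unfolding augmenting_path_def using p ne assms by auto
qed

text \<open>
  Without an augmenting path, every neighbour of the set \<open>R\<close> of agents reachable from \<open>i\<close> is
  matched to an agent of \<open>R - {i}\<close>, so \<open>R\<close> violates Hall's condition.
\<close>

lemma augmenting_path_exists:
  assumes \<mu>: "matching \<mu>" "\<mu> \<subseteq> E" and fin: "finite (fst ` E)"
    and i: "i \<in> fst ` E" "i \<notin> fst ` \<mu>" and sat: "saturable E"
  shows "\<exists>p. augmenting_path E \<mu> i p"
proof (rule ccontr)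
  assume no: "\<nexists>p. augmenting_path E \<mu> i p"
  define R where "R = {b. \<exists>p. alternating E \<mu> i p b}"
  have iR: "i \<in> R"
    unfolding R_def by (blast intro: alternating.start)
  have R: "R \<subseteq> fst ` E"
  proof
    fix b assume "b \<in> R"
    then obtain p where "alternating E \<mu> i p b" unfolding R_def by blast
    then show "b \<in> fst ` E"
      using i by cases force+
  qed
  have step: "\<exists>c\<in>R. (c, x) \<in> \<mu>" if b: "b \<in> R" and bx: "(b, x) \<in> E" for b x
  proof -
    obtain p where p: "alternating E \<mu> i p b" using b unfolding R_def by blast
    show ?thesis
    \<comment> \<open>For an edge of \<open>\<mu>\<close> the partner is \<open>b\<close> itself,
      and an object on the path has a reachable partner. A new object cannot be free, as the path
      would become augmenting, so its partner is on the path or extends it.\<close>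
    proof (cases "(b, x) \<in> \<mu> \<or> Inr x \<in> set p")
      case True
      then show ?thesis
        using b alternating_vertices[OF p, of _ x] unfolding R_def by blast
    next
      case False
      then have "x \<in> snd ` \<mu>"
        using no augmenting_path_snoc[OF p, of x] bx by blast
      then obtain c where c: "(c, x) \<in> \<mu>" by auto
      have "c \<in> R"
      proof (cases "Inl c \<in> set p")
        case True
        then show ?thesis using alternating_vertices[OF p] unfolding R_def by blast
      next
        case no_c: False
        have "alternating E \<mu> i (p @ [Inr x, Inl c]) c"
          using p bx c False no_c \<mu>(2) by (intro alternating.extend) auto
        then show ?thesis unfolding R_def by blast
      qed
      then show ?thesis using c by blast
    qed
  qed
  obtain M where M: "matching M" "M \<subseteq> E" "fst ` M = fst ` E"
    using sat unfolding saturable_def saturating_def by blast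
  have "\<exists>x c. (b, x) \<in> M \<and> c \<in> R \<and> (c, x) \<in> \<mu>" if "b \<in> R" for b
  proof -
    have "b \<in> fst ` M" using R M(3) that by blast
    then obtain x where "(b, x) \<in> M" by auto
    then show ?thesis using step[OF that] M(2) by blast
  qed
  \<comment> \<open>\<open>f b\<close> is the partner of \<open>b\<close> in \<open>M\<close>, and
    \<open>g b\<close> is the agent holding \<open>f b\<close> in \<open>\<mu>\<close>. Since both
    are matchings, \<open>g\<close> is injective, and it misses \<open>i\<close>, who is unmatched
    in \<open>\<mu>\<close>; a finite \<open>R\<close> does not inject into
    \<open>R - {i}\<close>.\<close>
  then obtain f g where fg: "\<And>b. b \<in> R \<Longrightarrow> (b, f b) \<in> M \<and> g b \<in> R \<and> (g b, f b) \<in> \<mu>"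
    by metis
  have "inj_on g R"
  proof (rule inj_onI)
    fix b c assume "b \<in> R" "c \<in> R" "g b = g c"
    then show "b = c"
      using fg[of b] fg[of c] matchingD[OF \<mu>(1), of "g b" "f b" "g c" "f c"]
        matchingD[OF M(1), of b "f b" c "f c"] by simp
  qed
  moreover have "g ` R \<subseteq> R - {i}"
    using fg i(2) by force
  moreover have "finite R"
    using R fin by (rule finite_subset)
  ultimately show False
    using iR card_inj_on_le[of g R "R - {i}"] card_Diff1_less[of R i] by simp
qed

section \<open>Evolution of the edge set\<close>

text \<open>
  The case of an exhausted list is included: there \<open>C k = {}\<close>, so the edge set is unchanged.
\<close>

lemma process_saturating:
  assumes "process C i l s s'" "s = (E, \<mu>)" "saturating E \<mu>" "finite (fst ` E)" "i \<notin> fst ` E"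
  shows "\<exists>k\<ge>l. fst s' = E \<union> {i} \<times> C k \<and> saturating (fst s') (snd s') \<and>
    (\<forall>j. l \<le> j \<and> j < k \<longrightarrow> \<not> saturable (E \<union> {i} \<times> C j))"
  using assms
proof induction
  case (exhausted l E \<mu>)
  then show ?case by (intro exI[of _ l]) auto
next
  case (augment l E' E \<mu> p)
  then show ?case
    using saturating_augment[of _ _ i "C l" p] by (intro exI[of _ l]) auto
next
  case (next_class l E0 \<mu>0 s)
  then have eq: "E0 = E" "\<mu>0 = \<mu>" by auto
  have \<mu>: "matching \<mu>" "\<mu> \<subseteq> E" "fst ` \<mu> = fst ` E"
    using next_class.prems by (auto simp: saturating_def)
  \<comment> \<open>\<open>\<mu>\<close> is still a matching of the extended graph and leaves
    \<open>i\<close> unmatched, although \<open>i\<close> now has edges. Saturability would thus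
    yield the augmenting path whose absence led to the next class.\<close>
  have "\<not> saturable (E \<union> {i} \<times> C l)"
  proof
    assume "saturable (E \<union> {i} \<times> C l)"
    moreover have "\<mu> \<subseteq> E \<union> {i} \<times> C l"
      using \<mu>(2) by blast
    moreover have "finite (fst ` (E \<union> {i} \<times> C l))" "i \<in> fst ` (E \<union> {i} \<times> C l)"
      using next_class.prems next_class.hyps by (auto simp: image_Un)
    ultimately show False
      using augmenting_path_exists[of \<mu> "E \<union> {i} \<times> C l" i] \<mu> next_class eq by auto
  qed
  moreover obtain k where "k \<ge> Suc l" "fst s = E \<union> {i} \<times> C k" "saturating (fst s) (snd s)"
    "\<forall>j. Suc l \<le> j \<and> j < k \<longrightarrow> \<not> saturable (E \<union> {i} \<times> C j)"
    using next_class.IH[OF next_class.prems] by blast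
  ultimately show ?case
    by (metis Suc_leD Suc_leI le_neq_implies_less)
qed

text \<open>The final index is the least \<open>k \<ge> l\<close> for which the extended graph is
  saturable. This depends on \<open>E\<close> alone, not on the matching or the chosen path; an
  empty class qualifies because \<open>E\<close> is already saturated.\<close>

lemma process_edges_unique:
  assumes "process C i l (E, \<mu>\<^sub>1) (E\<^sub>1, \<nu>\<^sub>1)" "process C i l (E, \<mu>\<^sub>2) (E\<^sub>2, \<nu>\<^sub>2)"
    and "saturating E \<mu>\<^sub>1" "saturating E \<mu>\<^sub>2" "finite (fst ` E)" "i \<notin> fst ` E"
  shows "E\<^sub>1 = E\<^sub>2"
proof -
  obtain k\<^sub>1 where k1: "l \<le> k\<^sub>1" "E\<^sub>1 = E \<union> {i} \<times> C k\<^sub>1" "saturating E\<^sub>1 \<nu>\<^sub>1"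
    "\<forall>j. l \<le> j \<and> j < k\<^sub>1 \<longrightarrow> \<not> saturable (E \<union> {i} \<times> C j)"
    using process_saturating[OF assms(1) refl] assms by auto
  obtain k\<^sub>2 where k2: "l \<le> k\<^sub>2" "E\<^sub>2 = E \<union> {i} \<times> C k\<^sub>2" "saturating E\<^sub>2 \<nu>\<^sub>2"
    "\<forall>j. l \<le> j \<and> j < k\<^sub>2 \<longrightarrow> \<not> saturable (E \<union> {i} \<times> C j)"
    using process_saturating[OF assms(2) refl] assms by auto
  have "saturable (E \<union> {i} \<times> C k\<^sub>1)" "saturable (E \<union> {i} \<times> C k\<^sub>2)"
    using k1 k2 unfolding saturable_def by auto
  then have "k\<^sub>1 = k\<^sub>2"
    using k1 k2 by (metis linorder_neqE_nat)
  then show ?thesis using k1 k2 by simp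
qed

text \<open>Each agent adds edges only at himself, so the edges of processed agents are final, even
  though later augmentations may change their partners.\<close>

lemma run_saturating:
  assumes "sdmt1_run L \<sigma> s s'" "s = (E, \<mu>)" "saturating E \<mu>" "finite (fst ` E)"
    "distinct \<sigma>" "set \<sigma> \<inter> fst ` E = {}"
  shows "saturating (fst s') (snd s') \<and> finite (fst ` fst s') \<and>
    E \<subseteq> fst s' \<and> fst s' \<subseteq> E \<union> set \<sigma> \<times> UNIV"
  using assms
proof (induction arbitrary: E \<mu>)
  case (finished s)
  then show ?case by simp
next
  case (agent i s s' \<sigma> s'')
  obtain k where k: "fst s' = E \<union> {i} \<times> L i k" "saturating (fst s') (snd s')"
    using process_saturating[OF agent.hyps(1) agent.prems(1)] agent.prems by auto
  \<comment> \<open>Only an inclusion: if \<open>L i k\<close> is empty, \<open>i\<close> obtains no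
    edges.\<close>
  have sub: "fst ` fst s' \<subseteq> insert i (fst ` E)"
    using k by auto
  then have "finite (fst ` fst s')"
    using agent.prems finite_subset by auto
  moreover have "set \<sigma> \<inter> fst ` fst s' = {}"
    using sub agent.prems by auto
  ultimately have "saturating (fst s'') (snd s'') \<and> finite (fst ` fst s'') \<and>
      fst s' \<subseteq> fst s'' \<and> fst s'' \<subseteq> fst s' \<union> set \<sigma> \<times> UNIV"
    using agent.IH[OF prod.collapse[symmetric]] k(2) agent.prems(4) by simp
  then show ?case using k by auto
qed

text \<open>Meant for the predecessors of the misreporting agent. The runs may choose different
  paths, so the induction carries two matchings over one edge set.\<close>

lemma run_edges_unique:
  assumes "sdmt1_run L \<sigma> (E, \<mu>\<^sub>1) s\<^sub>1" "sdmt1_run L' \<sigma> (E, \<mu>\<^sub>2) s\<^sub>2" "\<forall>j\<in>set \<sigma>. L j = L' j"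
    "saturating E \<mu>\<^sub>1" "saturating E \<mu>\<^sub>2" "finite (fst ` E)" "distinct \<sigma>" "set \<sigma> \<inter> fst ` E = {}"
  shows "fst s\<^sub>1 = fst s\<^sub>2"
  using assms
proof (induction \<sigma> arbitrary: E \<mu>\<^sub>1 \<mu>\<^sub>2)
  case Nil
  then show ?case by (auto elim!: sdmt1_run.cases)
next
  case (Cons i \<sigma>)
  obtain F\<^sub>1 \<nu>\<^sub>1 where 1: "process (L i) i 1 (E, \<mu>\<^sub>1) (F\<^sub>1, \<nu>\<^sub>1)" "sdmt1_run L \<sigma> (F\<^sub>1, \<nu>\<^sub>1) s\<^sub>1"
    using Cons.prems(1) by (auto elim: sdmt1_run.cases)
  obtain F\<^sub>2 \<nu>\<^sub>2 where 2: "process (L i) i 1 (E, \<mu>\<^sub>2) (F\<^sub>2, \<nu>\<^sub>2)" "sdmt1_run L' \<sigma> (F\<^sub>2, \<nu>\<^sub>2) s\<^sub>2"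
    using Cons.prems(2,3) by (auto elim: sdmt1_run.cases)
  have i: "i \<notin> fst ` E" using Cons.prems by auto
  have F: "F\<^sub>2 = F\<^sub>1"
    using process_edges_unique[OF 1(1) 2(1)] Cons.prems i by simp
  obtain k where k: "F\<^sub>1 = E \<union> {i} \<times> L i k" "saturating F\<^sub>1 \<nu>\<^sub>1"
    using process_saturating[OF 1(1) refl] Cons.prems i by auto
  have "saturating F\<^sub>1 \<nu>\<^sub>2"
    using process_saturating[OF 2(1) refl] Cons.prems i F by auto
  moreover have sub: "fst ` F\<^sub>1 \<subseteq> insert i (fst ` E)"
    using k by auto
  moreover have "finite (fst ` F\<^sub>1)"
    using sub Cons.prems finite_subset by auto
  moreover have "set \<sigma> \<inter> insert i (fst ` E) = {}"
    using Cons.prems by auto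
  then have "set \<sigma> \<inter> fst ` F\<^sub>1 = {}"
    using sub by blast
  ultimately show ?case
    using Cons.IH[of F\<^sub>1 \<nu>\<^sub>1 \<nu>\<^sub>2] 1 2 F k Cons.prems by auto
qed

section \<open>Cutting a run at the misreporting agent, and truthfulness\<close>

lemma sdmt1_run_append:
  assumes "sdmt1_run L (\<sigma> @ \<tau>) s s''"
  shows "\<exists>s'. sdmt1_run L \<sigma> s s' \<and> sdmt1_run L \<tau> s' s''"
  using assms
proof (induction \<sigma> arbitrary: s)
  case Nil
  then show ?case by (metis append_Nil finished)
next
  case (Cons i \<sigma>)
  obtain t where t: "process (L i) i 1 s t" "sdmt1_run L (\<sigma> @ \<tau>) t s''"
    using Cons.prems by (auto elim: sdmt1_run.cases)
  then show ?case using Cons.IH[of t] by (blast intro: agent)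
qed

text \<open>Here \<open>E\<^sub>0\<close> is the graph when \<open>i\<close> is reached and
  \<open>k\<close> is the index at which his processing stops, possibly at an empty class. Later
  agents contribute only edges of their own, so the bounds on \<open>E\<close> fix the edges of
  \<open>i\<close> and of his predecessors.\<close>

lemma sdmt1_splitE:
  assumes "sdmt1 (\<sigma> @ i # \<tau>) L \<mu>" "distinct (\<sigma> @ i # \<tau>)"
  obtains E\<^sub>0 \<mu>\<^sub>0 E k where "sdmt1_run L \<sigma> ({}, {}) (E\<^sub>0, \<mu>\<^sub>0)"
    "saturating E \<mu>" "fst ` E\<^sub>0 \<subseteq> set \<sigma>" "1 \<le> k"
    "E\<^sub>0 \<union> {i} \<times> L i k \<subseteq> E" "E \<subseteq> E\<^sub>0 \<union> {i} \<times> L i k \<union> set \<tau> \<times> UNIV"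
    "\<And>j. 1 \<le> j \<Longrightarrow> j < k \<Longrightarrow> \<not> saturable (E\<^sub>0 \<union> {i} \<times> L i j)"
proof -
  obtain E where "sdmt1_run L (\<sigma> @ i # \<tau>) ({}, {}) (E, \<mu>)"
    using assms(1) unfolding sdmt1_def by blast
  then obtain E\<^sub>0 \<mu>\<^sub>0 where r0: "sdmt1_run L \<sigma> ({}, {}) (E\<^sub>0, \<mu>\<^sub>0)"
    and "sdmt1_run L (i # \<tau>) (E\<^sub>0, \<mu>\<^sub>0) (E, \<mu>)"
    using sdmt1_run_append by (metis surj_pair)
  then obtain E\<^sub>1 \<mu>\<^sub>1 where p: "process (L i) i 1 (E\<^sub>0, \<mu>\<^sub>0) (E\<^sub>1, \<mu>\<^sub>1)"
    and r1: "sdmt1_run L \<tau> (E\<^sub>1, \<mu>\<^sub>1) (E, \<mu>)"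
    by (auto elim: sdmt1_run.cases)
  have s0: "saturating E\<^sub>0 \<mu>\<^sub>0" "finite (fst ` E\<^sub>0)" "fst ` E\<^sub>0 \<subseteq> set \<sigma>"
    using run_saturating[OF r0 refl] assms(2) by (auto simp: saturating_def matching_def)
  then have "i \<notin> fst ` E\<^sub>0" using assms(2) by auto
  then obtain k where k: "1 \<le> k" "E\<^sub>1 = E\<^sub>0 \<union> {i} \<times> L i k" "saturating E\<^sub>1 \<mu>\<^sub>1"
    "\<And>j. 1 \<le> j \<Longrightarrow> j < k \<Longrightarrow> \<not> saturable (E\<^sub>0 \<union> {i} \<times> L i j)"
    using process_saturating[OF p refl] s0 by auto
  have sub: "fst ` E\<^sub>1 \<subseteq> insert i (fst ` E\<^sub>0)"
    using k by auto
  then have "finite (fst ` E\<^sub>1)"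
    using s0(2) by (metis finite.insertI finite_subset)
  moreover have "set \<tau> \<inter> fst ` E\<^sub>1 = {}"
    using sub s0(3) assms(2) by auto
  ultimately have "saturating E \<mu>" "E\<^sub>1 \<subseteq> E" "E \<subseteq> E\<^sub>1 \<union> set \<tau> \<times> UNIV"
    using run_saturating[OF r1 refl] k assms(2) by auto
  then show thesis
    using that r0 s0 k by blast
qed

theorem theorem3p4:
  fixes N :: "'a set" and Ob :: "'o set" and \<sigma> :: "'a list"
  assumes "finite N" and "finite Ob"
    and "distinct \<sigma>" and "set \<sigma> = N"
  shows "truthful N Ob (sdmt1 \<sigma>)"
  unfolding truthful_def
proof (intro allI impI)
  fix L i C' \<mu> \<mu>'
  assume prof: "pref_profile N Ob L" and i: "i \<in> N"
    and run: "sdmt1 \<sigma> L \<mu>" and run': "sdmt1 \<sigma> (L(i := C')) \<mu>'"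
  have pl: "pref_list Ob (L i)"
    using prof i unfolding pref_profile_def by blast
  obtain \<pi> \<tau> where \<sigma>: "\<sigma> = \<pi> @ i # \<tau>"
    using i assms(4) split_list by metis
  then have dist: "distinct (\<pi> @ i # \<tau>)"
    using assms(3) by simp
  obtain E\<^sub>0 \<mu>\<^sub>0 E k where r: "sdmt1_run L \<pi> ({}, {}) (E\<^sub>0, \<mu>\<^sub>0)" "saturating E \<mu>"
    "fst ` E\<^sub>0 \<subseteq> set \<pi>" "1 \<le> k" "E\<^sub>0 \<union> {i} \<times> L i k \<subseteq> E"
    "E \<subseteq> E\<^sub>0 \<union> {i} \<times> L i k \<union> set \<tau> \<times> UNIV"
    "\<And>j. 1 \<le> j \<Longrightarrow> j < k \<Longrightarrow> \<not> saturable (E\<^sub>0 \<union> {i} \<times> L i j)"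
    by (rule sdmt1_splitE[OF run[unfolded \<sigma>] dist]) blast
  obtain F\<^sub>0 \<nu>\<^sub>0 E' k' where r': "sdmt1_run (L(i := C')) \<pi> ({}, {}) (F\<^sub>0, \<nu>\<^sub>0)"
    "saturating E' \<mu>'" "F\<^sub>0 \<union> {i} \<times> (L(i := C')) i k' \<subseteq> E'"
    "E' \<subseteq> F\<^sub>0 \<union> {i} \<times> (L(i := C')) i k' \<union> set \<tau> \<times> UNIV"
    by (rule sdmt1_splitE[OF run'[unfolded \<sigma>] dist]) blast
  \<comment> \<open>The predecessors of \<open>i\<close> report the same lists in both runs.\<close>
  have F: "F\<^sub>0 = E\<^sub>0"
    using run_edges_unique[OF r(1) r'(1)] dist by (auto simp: saturating_def matching_def)
  have m: "matching \<mu>" and m': "matching \<mu>'"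
    using r r' by (auto simp: saturating_def)
  \<comment> \<open>All final edges of \<open>i\<close> lead into \<open>L i k\<close> and the final
    matching saturates him, so later augmentations can only move him within this class.\<close>
  have L_k: "rank Ob (L i) (outcome \<mu> i) = k" if ne: "L i k \<noteq> {}"
  proof -
    obtain z where "z \<in> L i k" using ne by blast
    then have "(i, z) \<in> E" using r(5) by auto
    then have "i \<in> fst ` \<mu>"
      using r(2) unfolding saturating_def by (metis fst_conv image_eqI)
    then obtain x where x: "(i, x) \<in> \<mu>" by auto
    then have "(i, x) \<in> E" using r(2) by (auto simp: saturating_def)
    then have "x \<in> L i k" using r(3,6) dist by force
    then show ?thesis
      using x rank_eq[OF pl r(4)] m by (simp add: outcome_eq_Some_iff[symmetric])
  qed
  have L_None: "rank Ob (L i) (outcome \<mu> i) = card Ob + 1" if "L i k = {}"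
  proof -
    have "(i, x) \<notin> E" for x using that r(3,6) dist by force
    then have "outcome \<mu> i = None"
      using r(2) by (auto simp: saturating_def outcome_def)
    then show ?thesis by (simp add: rank_def)
  qed
  \<comment> \<open>Nonempty classes have index at most \<open>card Ob\<close>, so the default rank
    is the worst one. This settles the case in which misreporting yields nothing acceptable.\<close>
  have bound: "rank Ob (L i) (outcome \<mu> i) \<le> card Ob + 1"
    using L_k L_None pref_list_bounded[OF assms(2) pl, of k] by (cases "L i k = {}") force+
  show "weakly_prefers Ob (L i) (outcome \<mu> i) (outcome \<mu>' i)"
  proof (cases "\<exists>y. outcome \<mu>' i = Some y \<and> y \<in> acceptable (L i)")
    case False
    then have "rank Ob (L i) (outcome \<mu>' i) = card Ob + 1"
      by (auto simp: rank_def split: option.split)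
    then show ?thesis using bound by (simp add: weakly_prefers_def)
  next
    case True
    then obtain y where y: "outcome \<mu>' i = Some y" "y \<in> acceptable (L i)" by blast
    then obtain l where l: "1 \<le> l" "y \<in> L i l" by (auto simp: acceptable_def)
    have iy: "(i, y) \<in> \<mu>'" using y outcome_eq_Some_iff[OF m'] by simp
    \<comment> \<open>Dropping the agents after \<open>i\<close>, and any without edges before him,
      turns the misreporting outcome into a witness for the true class \<open>l\<close> of
      \<open>y\<close>: the only edge of \<open>i\<close> in \<open>M\<close> is
      \<open>(i, y)\<close>, whichever class he reported it in.\<close>
    define M where "M = {e \<in> \<mu>'. fst e \<in> insert i (fst ` E\<^sub>0)}"
    have "saturating (E\<^sub>0 \<union> {i} \<times> L i l) M"
      unfolding saturating_def
    proof (intro conjI)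
      show "matching M"
        using m' unfolding matching_def M_def by blast
      show "M \<subseteq> E\<^sub>0 \<union> {i} \<times> L i l"
      proof
        fix e assume e: "e \<in> M"
        show "e \<in> E\<^sub>0 \<union> {i} \<times> L i l"
        proof (cases "fst e = i")
          case True
          then show ?thesis
            using e iy l matchingD[OF m', of i y i "snd e"] by (cases e) (auto simp: M_def)
        next
          case False
          then have "fst e \<in> set \<pi>" "e \<in> E'"
            using e r(3) r'(2) by (auto simp: M_def saturating_def)
          then show ?thesis using r'(4) F False dist by (cases e) auto
        qed
      qed
      have "fst ` E\<^sub>0 \<subseteq> fst ` \<mu>'"
        using r'(2,3) F unfolding saturating_def by auto
      moreover have "i \<in> fst ` \<mu>'"
        using iy by (metis fst_conv image_eqI)
      moreover have "fst ` M = fst ` \<mu>' \<inter> insert i (fst ` E\<^sub>0)"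
        unfolding M_def by (intro equalityI subsetI) (auto intro: rev_image_eqI)
      ultimately have "fst ` M = insert i (fst ` E\<^sub>0)"
        by blast
      also have "\<dots> = fst ` (E\<^sub>0 \<union> {i} \<times> L i l)"
        using l by (auto simp: image_Un)
      finally show "fst ` M = fst ` (E\<^sub>0 \<union> {i} \<times> L i l)" .
    qed
    then have "k \<le> l"
      using r(7) l unfolding saturable_def by (meson not_le)
    \<comment> \<open>Empty classes come last, and the class \<open>L i l\<close> with
      \<open>k \<le> l\<close> contains \<open>y\<close>; so \<open>i\<close> is matched in the
      truthful run and has rank \<open>k\<close>.\<close>
    moreover have "L i k \<noteq> {}"
      using pl l r(4) \<open>k \<le> l\<close> unfolding pref_list_def by blast
    ultimately show ?thesis
      using L_k rank_eq[OF pl l] y by (simp add: weakly_prefers_def)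
  qed
qed

end
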